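(* Let $k\ge 1$, let $\beta_1,\ldots,\beta_k$ be real numbers that are all negative, and let $H_1,\ldots,H_k$ be finite simple graphs, where $H_1$ is a single edge. Let $(\alpha_n)$ be a sequence of real numbers with $\alpha_n\to\infty$ as $n\to\infty$, and let $\mathbb{P}^{(n)}$ be the exponential random graph measure on simple graphs on $\{1,\ldots,n\}$ with parameters $\beta_p^{(n)}=\beta_p\alpha_n$, $p=1,\ldots,k$ (defined in the context). Assume further that $\lim_{n\to\infty}n^2e^{2\alpha_n\beta_1}=0$ and $\lim_{n\to\infty}\frac{\alpha_n}{n}=0$. Then, for vertices $i,j$ such that $1,i,j$ are pairwise distinct, $$\lim_{n\to\infty}\frac{\mathbb{P}^{(n)}(X_{1i}=1,\,X_{1j}=1)}{e^{4\alpha_n\beta_1}}=1.$$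
   Context: Undirected simple graphs $G_n$ (no loops, no multiple edges) on the vertex set $\{1,\ldots,n\}$ are represented by arrays $(X_{ij})_{1\le i<j\le n}$ with $X_{ij}\in\{0,1\}$, where $X_{ij}=1$ if and only if there is an edge between $i$ and $j$. For a finite simple graph $H$ with $v(H)$ vertices, the homomorphism density is $t(H,G_n)=|\mathrm{hom}(H,G_n)|/n^{v(H)}$, where $\mathrm{hom}(H,G_n)$ is the set of edge-preserving maps $V(H)\to V(G_n)$. The measure $\mathbb{P}^{(n)}$ on the set of all such graphs is $$\mathbb{P}^{(n)}(G_n)=Z_n^{-1}\exp\left[n^2\sum_{p=1}^k\beta_p^{(n)}\,t(H_p,G_n)\right],\qquad \beta_p^{(n)}=\beta_p\alpha_n,$$ where $Z_n=\sum_{G_n}\exp\left[n^2\sum_{p=1}^k\beta_p^{(n)}\,t(H_p,G_n)\right]$ is the normalization, the sum being over all simple graphs on $\{1,\ldots,n\}$.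
   Formalization: The formal theorem additionally assumes that none of H_2,…,H_k has exactly one edge; without this the claim is false (if H_2 is also a single edge, the ratio tends to 0). *)

theory Defs
  imports "HOL-Probability.Probability" "Graph_Theory.Graph_Theory"
begin

(* A simple graph is a pair_graph of Graph_Theory: a finite loopless digraph with symmetric arc
   relation, so that the edge {u, v} is represented by the two arcs (u, v) and (v, u). *)

definition simple_graphs_on :: "'a set \<Rightarrow> 'a pair_pre_digraph set" where
  "simple_graphs_on V = {G. pair_graph G \<and> pverts G = V}"

definition edges :: "'a pair_pre_digraph \<Rightarrow> 'a set set" where
  "edges G = (\<lambda>(u, v). {u, v}) ` parcs G"

(* Homomorphisms are extensional functions (undefined outside the vertex set of H), so that they
   correspond one-to-one to the maps V(H) \<rightarrow> V(G). *)

definition graph_homs :: "'a pair_pre_digraph \<Rightarrow> 'b pair_pre_digraph \<Rightarrow> ('a \<Rightarrow> 'b) set" where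
  "graph_homs H G =
     {f \<in> pverts H \<rightarrow>\<^sub>E pverts G. \<forall>(u, v) \<in> parcs H. (f u, f v) \<in> parcs G}"

definition hom_density :: "'a pair_pre_digraph \<Rightarrow> 'b pair_pre_digraph \<Rightarrow> real" where
  "hom_density H G =
     real (card (graph_homs H G)) / real (card (pverts G)) ^ card (pverts H)"

definition ergm_weight ::
  "nat \<Rightarrow> (nat \<Rightarrow> real) \<Rightarrow> (nat \<Rightarrow> 'a pair_pre_digraph) \<Rightarrow> nat \<Rightarrow> nat pair_pre_digraph \<Rightarrow> real" where
  "ergm_weight k b H n G = exp (real n ^ 2 * (\<Sum>p = 1..k. b p * hom_density (H p) G))"

definition ergm_Z ::
  "nat \<Rightarrow> (nat \<Rightarrow> real) \<Rightarrow> (nat \<Rightarrow> 'a pair_pre_digraph) \<Rightarrow> nat \<Rightarrow> real" where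
  "ergm_Z k b H n = (\<Sum>G \<in> simple_graphs_on {1..n}. ergm_weight k b H n G)"

definition ergm ::
  "nat \<Rightarrow> (nat \<Rightarrow> real) \<Rightarrow> (nat \<Rightarrow> 'a pair_pre_digraph) \<Rightarrow> nat \<Rightarrow> nat pair_pre_digraph measure" where
  "ergm k b H n =
     point_measure (simple_graphs_on {1..n}) (\<lambda>G. ennreal (ergm_weight k b H n G / ergm_Z k b H n))"

definition edge_var :: "nat \<Rightarrow> nat \<Rightarrow> nat pair_pre_digraph \<Rightarrow> nat" where
  "edge_var i j G = (if (i, j) \<in> parcs G then 1 else 0)"

lemma finite_simple_graphs_on:
  assumes "finite V"
  shows "finite (simple_graphs_on V)"
proof (rule finite_subset)
  show "simple_graphs_on V \<subseteq> (\<lambda>E. \<lparr>pverts = V, parcs = E\<rparr>) ` Pow (V \<times> V)"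
  proof
    fix G assume G: "G \<in> simple_graphs_on V"
    then interpret pair_graph G by (simp add: simple_graphs_on_def)
    have "parcs G \<subseteq> V \<times> V"
      using G by (auto simp: simple_graphs_on_def dest: in_arcsD1 in_arcsD2)
    moreover have "G = \<lparr>pverts = V, parcs = parcs G\<rparr>"
      using G by (simp add: simple_graphs_on_def)
    ultimately show "G \<in> (\<lambda>E. \<lparr>pverts = V, parcs = E\<rparr>) ` Pow (V \<times> V)"
      by blast
  qed
qed (use assms in simp)

lemma simple_graphs_on_nonempty:
  assumes "finite V"
  shows "simple_graphs_on V \<noteq> {}"
proof -
  have "\<lparr>pverts = V, parcs = {}\<rparr> \<in> simple_graphs_on V"
    unfolding simple_graphs_on_def using assms
    by (auto intro!: pair_graph.intro pair_digraph.intro pair_pseudo_graph.intro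
        pair_fin_digraph.intro pair_sym_digraph.intro pair_loopfree_digraph.intro
        pair_wf_digraph.intro pair_fin_digraph_axioms.intro pair_sym_digraph_axioms.intro
        pair_loopfree_digraph_axioms.intro simp: symmetric_def sym_def)
  then show ?thesis by blast
qed

lemma ergm_Z_pos: "ergm_Z k b H n > 0"
  unfolding ergm_Z_def
  by (intro sum_pos finite_simple_graphs_on simple_graphs_on_nonempty)
     (auto simp: ergm_weight_def)

lemma prob_space_ergm: "prob_space (ergm k b H n)"
proof
  let ?S = "simple_graphs_on {1..n}"
  have "emeasure (ergm k b H n) (space (ergm k b H n)) =
        (\<Sum>G \<in> ?S. ennreal (ergm_weight k b H n G / ergm_Z k b H n))"
    unfolding ergm_def space_point_measure
    by (rule emeasure_point_measure_finite) (auto intro: finite_simple_graphs_on)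
  also have "\<dots> = ennreal (\<Sum>G \<in> ?S. ergm_weight k b H n G / ergm_Z k b H n)"
    using ergm_Z_pos[of k b H n] by (intro sum_ennreal) (simp add: ergm_weight_def)
  also have "(\<Sum>G \<in> ?S. ergm_weight k b H n G / ergm_Z k b H n) = 1"
    using ergm_Z_pos[of k b H n]
    unfolding sum_divide_distrib[symmetric] ergm_Z_def by (intro divide_self) simp
  finally show "emeasure (ergm k b H n) (space (ergm k b H n)) = 1" by simp
qed

end

theory Submission
  imports Defs
begin

text \<open>
  Up to a common factor contributed by the edgeless \<open>H\<^sub>p\<close>, a graph with \<open>m\<close> edges has weight at
  most \<open>q ^ m\<close> with \<open>q = exp (2 * \<alpha>\<^sub>n * \<beta>\<^sub>1)\<close>, since all parameters are negative. Summing over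
  all sets of edges gives at most \<open>exp (n\<^sup>2 * q)\<close>, which tends to \<open>1\<close>. Hence the empty graph
  dominates \<open>Z\<^sub>n\<close>, and the path \<open>i - 1 - j\<close> dominates among the graphs containing both edges. An
  \<open>H\<^sub>p\<close> with at least two edges has at least three non-isolated vertices, so its density in that
  path is \<open>O(1 / n ^ 3)\<close> and changes the exponent only by \<open>O(\<alpha>\<^sub>n / n) = o(1)\<close>.
\<close>

section \<open>Simple graphs encoded by their increasing arcs\<close>

definition upper_arcs :: "nat pair_pre_digraph \<Rightarrow> (nat \<times> nat) set" where
  "upper_arcs G = {(u, v) \<in> parcs G. u < v}"

lemma pair_graph_parcs_sym:
  assumes "pair_graph G"
  shows "(u, v) \<in> parcs G \<longleftrightarrow> (v, u) \<in> parcs G"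
proof -
  interpret pair_graph G by fact
  show ?thesis using arcs_symmetric by blast
qed

lemma pair_graph_parcs_eq:
  assumes "pair_graph G"
  shows "parcs G = upper_arcs G \<union> (upper_arcs G)\<inverse>"
proof -
  interpret pair_graph G by fact
  show ?thesis
    using pair_graph_parcs_sym[OF assms] no_loops'
    by (auto simp: upper_arcs_def) (metis linorder_neqE_nat)+
qed

lemma finite_upper_arcs: "pair_graph G \<Longrightarrow> finite (upper_arcs G)"
  by (rule finite_subset[of _ "parcs G"])
     (auto simp: upper_arcs_def pair_graph_def pair_digraph_def pair_fin_digraph_def
                 pair_fin_digraph_axioms_def)

lemma card_parcs:
  assumes "pair_graph G"
  shows "card (parcs G) = 2 * card (upper_arcs G)"
proof -
  have "card (upper_arcs G \<union> (upper_arcs G)\<inverse>) = card (upper_arcs G) + card ((upper_arcs G)\<inverse>)"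
    using finite_upper_arcs[OF assms]
    by (intro card_Un_disjoint) (auto simp: upper_arcs_def)
  then show ?thesis
    using pair_graph_parcs_eq[OF assms] by (simp add: card_inverse)
qed

lemma upper_arcs_subset:
  assumes "G \<in> simple_graphs_on V"
  shows "upper_arcs G \<subseteq> V \<times> V"
proof -
  interpret pair_graph G using assms by (simp add: simple_graphs_on_def)
  show ?thesis
    using assms in_arcsD1 in_arcsD2 by (auto simp: upper_arcs_def simple_graphs_on_def)
qed

text \<open>By symmetry and looplessness the increasing arcs determine all arcs. A sum over graphs
  can therefore be rewritten as a sum over sets of arcs.\<close>

lemma inj_on_upper_arcs: "inj_on upper_arcs (simple_graphs_on V)"
proof (rule inj_onI)
  fix G G' :: "nat pair_pre_digraph"
  assume *: "G \<in> simple_graphs_on V" "G' \<in> simple_graphs_on V" and "upper_arcs G = upper_arcs G'"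
  then have "parcs G = parcs G'"
    using pair_graph_parcs_eq[of G] pair_graph_parcs_eq[of G'] by (simp add: simple_graphs_on_def)
  with * show "G = G'"
    by (simp add: simple_graphs_on_def pair_pre_digraph.equality)
qed

section \<open>Homomorphism densities: exact values and a cubic bound\<close>

lemma hom_density_edgeless:
  assumes "finite (pverts H)" "parcs H = {}" "pverts G \<noteq> {}" "finite (pverts G)"
  shows "hom_density H G = 1"
  using assms by (simp add: hom_density_def graph_homs_def card_funcsetE)

lemma hom_density_into_edgeless:
  assumes "parcs H \<noteq> {}" "parcs G = {}"
  shows "hom_density H G = 0"
proof -
  have "graph_homs H G = {}"
    using assms by (fastforce simp: graph_homs_def)
  then show ?thesis by (simp add: hom_density_def)
qed

lemma hom_density_nonneg: "hom_density H G \<ge> 0"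
  by (simp add: hom_density_def)

text \<open>Mapping a single edge into \<open>G\<close> amounts to choosing an arc of
  \<open>G\<close>, and each edge carries two arcs. The factor 2 becomes the exponent
  \<open>2 * b 1\<close> per edge.\<close>

lemma hom_density_K2:
  assumes "K\<^bsub>2\<^esub> (with_proj H)" "pair_graph G"
  shows "hom_density H G = 2 * real (card (upper_arcs G)) / real (card (pverts G)) ^ 2"
proof -
  interpret G: pair_graph G by fact
  from assms(1) have card: "card (pverts H) = 2"
    and arcs: "parcs H = {(u, v). (u, v) \<in> pverts H \<times> pverts H \<and> u \<noteq> v}"
    by (auto simp: complete_digraph_pair_def)
  from card obtain a b where ab: "pverts H = {a, b}" "a \<noteq> b"
    by (auto simp: card_2_iff)
  with arcs have arcs: "parcs H = {(a, b), (b, a)}" by auto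
  have "bij_betw (\<lambda>f. (f a, f b)) (graph_homs H G) (parcs G)"
  \<comment> \<open>Homomorphisms are extensional, so the inverse has to return
    \<open>undefined\<close> off \<open>{a, b}\<close>.\<close>
  proof (rule bij_betw_byWitness[where f' = "\<lambda>(x, y). (\<lambda>z. undefined)(a := x, b := y)"])
    show "\<forall>f\<in>graph_homs H G. (case (f a, f b) of (x, y) \<Rightarrow> (\<lambda>z. undefined)(a := x, b := y)) = f"
      using ab by (auto simp: graph_homs_def fun_eq_iff PiE_def extensional_def)
    show "(\<lambda>f. (f a, f b)) ` graph_homs H G \<subseteq> parcs G"
      using arcs by (auto simp: graph_homs_def)
    show "(\<lambda>(x, y). (\<lambda>z. undefined)(a := x, b := y)) ` parcs G \<subseteq> graph_homs H G"
      using arcs ab G.in_arcsD1 G.in_arcsD2 pair_graph_parcs_sym[OF assms(2)]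
      by (auto simp: graph_homs_def PiE_def extensional_def)
  qed (use ab in auto)
  then have "card (graph_homs H G) = card (parcs G)"
    by (rule bij_betw_same_card)
  then show ?thesis
    by (simp add: hom_density_def card card_parcs[OF assms(2)])
qed

text \<open>Two different edges are distinct two-element sets, so some endpoint of the second lies
  outside the first. As arcs are symmetric, \<open>Domain (parcs H)\<close> is the set of
  non-isolated vertices.\<close>

lemma three_nonisolated_vertices:
  assumes "pair_graph H" "parcs H \<noteq> {}" "card (edges H) \<noteq> 1"
  obtains W where "W \<subseteq> Domain (parcs H)" "card W = 3"
proof -
  interpret pair_graph H by fact
  from assms(2) obtain a b where ab: "(a, b) \<in> parcs H" by auto
  have "edges H \<noteq> {{a, b}}" using assms(3) by auto
  moreover have "{a, b} \<in> edges H" using ab by (force simp: edges_def)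
  ultimately obtain e where "e \<in> edges H" "e \<noteq> {a, b}" by blast
  then obtain c d where cd: "(c, d) \<in> parcs H" "{c, d} \<noteq> {a, b}"
    by (auto simp: edges_def)
  have neq: "a \<noteq> b" "c \<noteq> d" using no_loops' ab cd by auto
  have dom: "a \<in> Domain (parcs H)" "b \<in> Domain (parcs H)" "c \<in> Domain (parcs H)"
    "d \<in> Domain (parcs H)"
    using ab cd pair_graph_parcs_sym[OF assms(1)] by blast+
  obtain w where "w \<in> {c, d}" "w \<notin> {a, b}"
    using neq cd(2) by blast
  show ?thesis
  proof
    show "{a, b, w} \<subseteq> Domain (parcs H)" using dom \<open>w \<in> {c, d}\<close> by blast
    show "card {a, b, w} = 3" using neq(1) \<open>w \<notin> {a, b}\<close> by auto
  qed
qed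

text \<open>Homomorphisms send non-isolated vertices to non-isolated ones. Three vertices of
  \<open>H\<close> are thus confined to \<open>Domain (parcs G)\<close>, while the others move
  freely. For \<open>G\<close> with boundedly many edges the cube outweighs the prefactor n^2 in the
  exponent.\<close>

lemma hom_density_le_cube:
  assumes H: "pair_graph H" "parcs H \<noteq> {}" "card (edges H) \<noteq> 1"
    and G: "pair_graph G" "pverts G \<noteq> {}"
  shows "hom_density H G \<le> (real (card (Domain (parcs G))) / real (card (pverts G))) ^ 3"
proof -
  interpret H: pair_graph H by fact
  interpret G: pair_graph G by fact
  obtain W where W: "W \<subseteq> Domain (parcs H)" "card W = 3"
    using three_nonisolated_vertices[OF H] .
  let ?D = "Domain (parcs G)" and ?n = "card (pverts G)"
  have WV: "W \<subseteq> pverts H" using W(1) H.in_arcsD1 by blast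
  have D: "finite ?D" by (simp add: G.pair_finite_arcs finite_Domain)
  have n: "?n > 0" using G G.pair_finite_verts by (simp add: card_gt_0_iff)
  let ?P = "\<Pi>\<^sub>E x\<in>pverts H. if x \<in> W then ?D else pverts G"
  have "graph_homs H G \<subseteq> ?P"
  proof
    fix f assume f: "f \<in> graph_homs H G"
    have "f x \<in> Domain (parcs G)" if "x \<in> W" for x
    proof -
      from that W(1) obtain y where "(x, y) \<in> parcs H" by blast
      with f have "(f x, f y) \<in> parcs G" by (auto simp: graph_homs_def)
      then show ?thesis by (rule DomainI)
    qed
    with f show "f \<in> ?P" by (simp add: graph_homs_def PiE_iff)
  qed
  then have "card (graph_homs H G) \<le> card ?P"
    by (intro card_mono finite_PiE) (auto simp: D G.pair_finite_verts H.pair_finite_verts)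
  also have "card ?P = (\<Prod>x\<in>pverts H. if x \<in> W then card ?D else ?n)"
    by (simp add: card_PiE H.pair_finite_verts if_distrib cong: if_cong)
  also have "\<dots> = card ?D ^ card (pverts H \<inter> W) * ?n ^ card (pverts H - W)"
    by (simp add: prod.If_cases H.pair_finite_verts Diff_eq)
  also have "pverts H \<inter> W = W" using WV by blast
  finally have "real (card (graph_homs H G)) \<le> real (card ?D) ^ 3 * real ?n ^ card (pverts H - W)"
    unfolding W(2) by (simp flip: of_nat_power of_nat_mult)
  moreover have "card (pverts H) = 3 + card (pverts H - W)"
    using card_mono[OF H.pair_finite_verts WV] WV W(2) finite_subset[OF WV H.pair_finite_verts]
    by (simp add: card_Diff_subset)
  ultimately show ?thesis
    using n by (simp add: hom_density_def divide_simps power_add)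
qed

section \<open>Factorisation of the weight of a graph\<close>

definition edgeless_weight ::
  "nat \<Rightarrow> (nat \<Rightarrow> real) \<Rightarrow> (nat \<Rightarrow> 'a pair_pre_digraph) \<Rightarrow> nat \<Rightarrow> real" where
  "edgeless_weight k b H n = exp (real n ^ 2 * (\<Sum>p\<in>{p \<in> {2..k}. parcs (H p) = {}}. b p))"

text \<open>The \<open>H p\<close> fall into three kinds. For the single edge, n^2 cancels the
  denominator of the density, leaving an exponent linear in the number of edges. Edgeless
  \<open>H p\<close> have density 1, so their factor is the same for every \<open>G\<close> and will
  cancel in probabilities. The rest stay as an error factor.\<close>

lemma ergm_weight_eq:
  assumes "1 \<le> k" "\<And>p. p \<in> {1..k} \<Longrightarrow> pair_graph (H p)" "K\<^bsub>2\<^esub> (with_proj (H 1))"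
    and G: "G \<in> simple_graphs_on {1..n}" and n: "n \<ge> 1"
  shows "ergm_weight k b H n G =
    edgeless_weight k b H n * exp (2 * b 1) ^ card (upper_arcs G) *
    exp (real n ^ 2 * (\<Sum>p\<in>{p \<in> {2..k}. parcs (H p) \<noteq> {}}. b p * hom_density (H p) G))"
proof -
  let ?E = "{p \<in> {2..k}. parcs (H p) = {}}" and ?J = "{p \<in> {2..k}. parcs (H p) \<noteq> {}}"
  let ?f = "\<lambda>p. b p * hom_density (H p) G"
  have V: "pverts G = {1..n}" and "pair_graph G" using G by (auto simp: simple_graphs_on_def)
  have "{1..k} = insert 1 (?E \<union> ?J)" using assms(1) by auto
  then have "sum ?f {1..k} = ?f 1 + (sum ?f ?E + sum ?f ?J)"
    by (simp add: sum.union_disjoint disjoint_iff)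
  also have "sum ?f ?E = sum b ?E"
  proof (rule sum.cong)
    fix p assume p: "p \<in> ?E"
    interpret pair_graph "H p" using assms(2)[of p] p by simp
    show "?f p = b p"
      using p n V pair_finite_verts by (simp add: hom_density_edgeless)
  qed simp
  also have "?f 1 = 2 * b 1 * real (card (upper_arcs G)) / real n ^ 2"
    using hom_density_K2[OF assms(3) \<open>pair_graph G\<close>] V by simp
  finally have *: "real n ^ 2 * sum ?f {1..k} =
      real n ^ 2 * sum b ?E + real (card (upper_arcs G)) * (2 * b 1) + real n ^ 2 * sum ?f ?J"
    using n by (simp add: field_simps)
  show ?thesis
    unfolding ergm_weight_def edgeless_weight_def * exp_add exp_of_nat_mult ..
qed

section \<open>Sums over graphs with prescribed edges\<close>

lemma sum_Pow_power_card:
  fixes q :: "'b::comm_semiring_1"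
  assumes "finite A"
  shows "(\<Sum>X\<in>Pow A. q ^ card X) = (1 + q) ^ card A"
  \<comment> \<open>Expanding the product of \<open>q + 1\<close> over \<open>A\<close> takes
    \<open>q\<close> on a subset and \<open>1\<close> off it.\<close>
  using prod_add[OF assms, of "\<lambda>_. q" "\<lambda>_. 1"] by (simp add: add.commute)

text \<open>Removing \<open>B\<close> is a bijection onto the subsets of \<open>A - B\<close>; the
  exponent \<open>card (A - B)\<close> is then relaxed to \<open>card A\<close>.\<close>

lemma sum_supersets_power_card_le:
  fixes q :: real
  assumes "finite A" "B \<subseteq> A" "q \<ge> 0"
  shows "(\<Sum>X\<in>{X \<in> Pow A. B \<subseteq> X}. q ^ card X) \<le> q ^ card B * (1 + q) ^ card A"
proof -
  have "(\<Sum>X\<in>{X \<in> Pow A. B \<subseteq> X}. q ^ card X) = (\<Sum>Y\<in>Pow (A - B). q ^ card (B \<union> Y))"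
    by (rule sum.reindex_bij_witness[where i = "\<lambda>Y. B \<union> Y" and j = "\<lambda>X. X - B"])
       (use assms in \<open>auto intro!: arg_cong[of _ _ "\<lambda>X. q ^ card X"]\<close>)
  also have "\<dots> = (\<Sum>Y\<in>Pow (A - B). q ^ card B * q ^ card Y)"
  proof (rule sum.cong)
    fix Y assume "Y \<in> Pow (A - B)"
    then have "card (B \<union> Y) = card B + card Y"
      using assms by (intro card_Un_disjoint) (auto intro: finite_subset)
    then show "q ^ card (B \<union> Y) = q ^ card B * q ^ card Y" by (simp add: power_add)
  qed simp
  also have "\<dots> = q ^ card B * (1 + q) ^ card (A - B)"
    using assms(1) by (simp add: sum_Pow_power_card flip: sum_distrib_left)
  also have "\<dots> \<le> q ^ card B * (1 + q) ^ card A"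
    using assms by (intro mult_left_mono power_increasing card_mono) auto
  finally show ?thesis .
qed

text \<open>The arc sets are relaxed to arbitrary subsets of the whole square, and
  \<open>1 + q\<close> to \<open>exp q\<close>. The exponent n^2 q is crude, but it is the quantity
  assumed to vanish in the limit.\<close>

lemma sum_graphs_power_card_le:
  fixes q :: real
  assumes "B \<subseteq> {1..n} \<times> {1..n}" "q \<ge> 0"
  shows "(\<Sum>G\<in>{G \<in> simple_graphs_on {1..n}. B \<subseteq> upper_arcs G}. q ^ card (upper_arcs G))
           \<le> q ^ card B * exp (real n ^ 2 * q)"
proof -
  let ?S = "{G \<in> simple_graphs_on {1..n}. B \<subseteq> upper_arcs G}" and ?A = "{1..n} \<times> {1..n}"
  have "inj_on upper_arcs ?S"
    by (rule inj_on_subset[OF inj_on_upper_arcs[of "{1..n}"]]) auto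
  then have "(\<Sum>G\<in>?S. q ^ card (upper_arcs G)) = (\<Sum>X\<in>upper_arcs ` ?S. q ^ card X)"
    by (simp add: sum.reindex)
  also have "\<dots> \<le> (\<Sum>X\<in>{X \<in> Pow ?A. B \<subseteq> X}. q ^ card X)"
    using upper_arcs_subset[of _ "{1..n}"] assms(2) by (intro sum_mono2) auto
  also have "\<dots> \<le> q ^ card B * (1 + q) ^ card ?A"
    using assms by (intro sum_supersets_power_card_le) auto
  also have "\<dots> \<le> q ^ card B * exp q ^ card ?A"
    using assms(2) by (intro mult_left_mono power_mono) auto
  also have "exp q ^ card ?A = exp (real n ^ 2 * q)"
    by (simp add: power2_eq_square flip: exp_of_nat_mult)
  finally show ?thesis .
qed

section \<open>Probability bounds at fixed \<open>n\<close>\<close>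

lemma measure_ergm:
  assumes "A \<subseteq> simple_graphs_on {1..n}"
  shows "measure (ergm k b H n) A = (\<Sum>G\<in>A. ergm_weight k b H n G) / ergm_Z k b H n"
proof -
  have nonneg: "0 \<le> ergm_weight k b H n G / ergm_Z k b H n" for G
    using ergm_Z_pos[of k b H n] by (simp add: ergm_weight_def)
  have "emeasure (ergm k b H n) A = (\<Sum>G\<in>A. ennreal (ergm_weight k b H n G / ergm_Z k b H n))"
    unfolding ergm_def using assms
    by (intro emeasure_point_measure_finite finite_simple_graphs_on) auto
  also have "\<dots> = ennreal (\<Sum>G\<in>A. ergm_weight k b H n G / ergm_Z k b H n)"
    using nonneg by (intro sum_ennreal) auto
  finally show ?thesis
    unfolding sum_divide_distrib
    by (intro measure_eq_emeasure_eq_ennreal sum_nonneg nonneg)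
qed

lemma in_simple_graphs_onI:
  assumes "finite V" "E \<subseteq> V \<times> V" "sym E" "\<And>u. (u, u) \<notin> E"
  shows "\<lparr>pverts = V, parcs = E\<rparr> \<in> simple_graphs_on V"
proof -
  have "finite E" using assms(1,2) finite_subset by blast
  then have "pair_graph \<lparr>pverts = V, parcs = E\<rparr>"
    using assms by unfold_locales (auto simp: symmetric_def)
  then show ?thesis by (simp add: simple_graphs_on_def)
qed

text \<open>Here \<open>q ^ 2\<close> is the expected main term. The other factors tend to 1 as soon
  as n^2 q tends to 0 and the parameters with index at least 2 are o(n).\<close>

lemma ergm_two_edges_bounds:
  fixes b :: "nat \<Rightarrow> real" and i j n :: nat
  assumes k: "1 \<le> k"
    and b: "\<And>p. p \<in> {1..k} \<Longrightarrow> b p \<le> 0"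
    and H: "\<And>p. p \<in> {1..k} \<Longrightarrow> pair_graph (H p)"
    and K2: "K\<^bsub>2\<^esub> (with_proj (H 1))"
    and edges: "\<And>p. p \<in> {2..k} \<Longrightarrow> card (edges (H p)) \<noteq> 1"
    and ij: "1 < i" "1 < j" "i \<noteq> j" "i \<le> n" "j \<le> n"
  defines "q \<equiv> exp (2 * b 1)"
  defines "A \<equiv> {G \<in> simple_graphs_on {1..n}. (1, i) \<in> parcs G \<and> (1, j) \<in> parcs G}"
  shows "measure (ergm k b H n) A \<le> q ^ 2 * exp (real n ^ 2 * q)" (is ?upper)
    and "measure (ergm k b H n) A
           \<ge> q ^ 2 * exp (27 / real n * (\<Sum>p=2..k. b p)) / exp (real n ^ 2 * q)" (is ?lower)
proof -
  let ?S = "simple_graphs_on {1..n}" and ?w = "ergm_weight k b H n"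
  let ?J = "{p \<in> {2..k}. parcs (H p) \<noteq> {}}"
  define C where "C = edgeless_weight k b H n"
  have C: "C > 0" by (simp add: C_def edgeless_weight_def)
  have q: "q > 0" by (simp add: q_def)
  have n: "n \<ge> 1" using ij by simp
  have finS: "finite ?S" by (simp add: finite_simple_graphs_on)
  \<comment> \<open>Vertex 1 is the smallest, so both required arcs are increasing and the event
    becomes a superset condition.\<close>
  have A: "A = {G \<in> ?S. {(1, i), (1, j)} \<subseteq> upper_arcs G}"
    using ij by (auto simp: A_def upper_arcs_def)
  have w: "?w G = C * q ^ card (upper_arcs G) *
      exp (real n ^ 2 * (\<Sum>p\<in>?J. b p * hom_density (H p) G))" if "G \<in> ?S" for G
    unfolding C_def q_def using k H K2 that n by (rule ergm_weight_eq)
  \<comment> \<open>The remaining density terms are nonpositive, so dropping them can only increase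
    the weight.\<close>
  have w_le: "?w G \<le> C * q ^ card (upper_arcs G)" if "G \<in> ?S" for G
  proof -
    have "(\<Sum>p\<in>?J. b p * hom_density (H p) G) \<le> 0"
      using b by (intro sum_nonpos mult_nonpos_nonneg hom_density_nonneg) auto
    then have "exp (real n ^ 2 * (\<Sum>p\<in>?J. b p * hom_density (H p) G)) \<le> 1"
      by (simp add: mult_nonneg_nonpos)
    then show ?thesis
      unfolding w[OF that] using C q by (intro mult_left_le) auto
  qed
  have num: "sum ?w A \<le> C * (q ^ 2 * exp (real n ^ 2 * q))"
  proof -
    have "sum ?w A \<le> (\<Sum>G\<in>A. C * q ^ card (upper_arcs G))"
      using w_le by (intro sum_mono) (auto simp: A_def)
    also have "\<dots> = C * (\<Sum>G\<in>A. q ^ card (upper_arcs G))"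
      by (simp add: sum_distrib_left)
    also have "(\<Sum>G\<in>A. q ^ card (upper_arcs G)) \<le> q ^ card {(1::nat, i), (1, j)} * exp (real n ^ 2 * q)"
      unfolding A using ij q by (intro sum_graphs_power_card_le) auto
    also have "card {(1::nat, i), (1, j)} = 2" using ij by simp
    finally show ?thesis using C by simp
  qed
  have Z_le: "ergm_Z k b H n \<le> C * exp (real n ^ 2 * q)"
  proof -
    have "ergm_Z k b H n \<le> (\<Sum>G\<in>?S. C * q ^ card (upper_arcs G))"
      unfolding ergm_Z_def using w_le by (intro sum_mono) auto
    also have "\<dots> = C * (\<Sum>G\<in>?S. q ^ card (upper_arcs G))"
      by (simp add: sum_distrib_left)
    also have "(\<Sum>G\<in>?S. q ^ card (upper_arcs G)) \<le> exp (real n ^ 2 * q)"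
      using sum_graphs_power_card_le[of "{}" n q] q by simp
    finally show ?thesis using C by simp
  qed
  have Z_ge: "C \<le> ergm_Z k b H n"
  proof -
    \<comment> \<open>In the empty graph every \<open>H p\<close> with an edge has density 0, so its
      weight is exactly \<open>C\<close>.\<close>
    let ?G = "\<lparr>pverts = {1..n}, parcs = {}\<rparr>"
    have G: "?G \<in> ?S" by (rule in_simple_graphs_onI) (auto simp: sym_def)
    have "?w ?G = C"
      unfolding w[OF G] by (simp add: upper_arcs_def hom_density_into_edgeless)
    moreover have "?w ?G \<le> ergm_Z k b H n"
      unfolding ergm_Z_def using finS G by (intro member_le_sum) (auto simp: ergm_weight_def)
    ultimately show ?thesis by simp
  qed
  have meas: "measure (ergm k b H n) A = sum ?w A / ergm_Z k b H n"
    by (rule measure_ergm) (auto simp: A_def)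
  have "sum ?w A / ergm_Z k b H n \<le> C * (q ^ 2 * exp (real n ^ 2 * q)) / C"
    using num Z_ge C q by (intro frac_le) auto
  then show ?upper using C by (simp add: meas)
  have "C * (q ^ 2 * exp (27 / real n * (\<Sum>p=2..k. b p))) \<le> sum ?w A"
  proof -
    \<comment> \<open>The path \<open>i - 1 - j\<close> with all other vertices isolated: the member
      of \<open>A\<close> with fewest edges.\<close>
    let ?G = "\<lparr>pverts = {1..n}, parcs = {(1, i), (i, 1), (1, j), (j, 1)}\<rparr>"
    have G: "?G \<in> ?S" using ij by (intro in_simple_graphs_onI) (auto simp: sym_def)
    then have pg: "pair_graph ?G" by (simp add: simple_graphs_on_def)
    have "upper_arcs ?G = {(1, i), (1, j)}"
      using ij by (auto simp: upper_arcs_def)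
    then have card: "card (upper_arcs ?G) = 2" using ij by simp
    have "Domain (parcs ?G) = {1, i, j}" by auto
    then have dom: "card (Domain (parcs ?G)) = 3" using ij by simp
    \<comment> \<open>Adding the edgeless indices lowers a sum of nonpositive terms.
      \<open>sum_mono2\<close> needs the added terms to be nonnegative, hence the negation.\<close>
    have "(\<Sum>p=2..k. b p * (3 / real n) ^ 3) \<le> (\<Sum>p\<in>?J. b p * (3 / real n) ^ 3)"
      using b by (intro sum_mono2[of _ _ "\<lambda>p. - (b p * (3 / real n) ^ 3)", simplified sum_negf neg_le_iff_le])
        (auto intro!: mult_nonpos_nonneg)
    also have "\<dots> \<le> (\<Sum>p\<in>?J. b p * hom_density (H p) ?G)"
    proof (intro sum_mono mult_left_mono_neg)
      fix p assume p: "p \<in> ?J"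
      show "b p \<le> 0" using p b by auto
      have "hom_density (H p) ?G \<le> (real (card (Domain (parcs ?G))) / real (card (pverts ?G))) ^ 3"
        using p n by (intro hom_density_le_cube H edges pg) auto
      then show "hom_density (H p) ?G \<le> (3 / real n) ^ 3"
        unfolding dom by simp
    qed
    finally have "real n ^ 2 * (\<Sum>p=2..k. b p * (3 / real n) ^ 3)
        \<le> real n ^ 2 * (\<Sum>p\<in>?J. b p * hom_density (H p) ?G)"
      by (intro mult_left_mono) auto
    \<comment> \<open>The constant 27 is 3^3, from the three non-isolated vertices of the path; n^2
      (3/n)^3 leaves 27/n.\<close>
    moreover have "real n ^ 2 * (\<Sum>p=2..k. b p * (3 / real n) ^ 3) = 27 / real n * (\<Sum>p=2..k. b p)"
      unfolding sum_distrib_right[symmetric] using n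
      by (simp add: field_simps power2_eq_square power3_eq_cube)
    ultimately have "C * (q ^ 2 * exp (27 / real n * (\<Sum>p=2..k. b p))) \<le> ?w ?G"
      unfolding w[OF G] card using C q by (simp add: mult.assoc)
    also have "?w ?G \<le> sum ?w A"
    proof (rule member_le_sum)
      show "?G \<in> A" using G by (simp add: A_def)
      show "finite A" using finS by (simp add: A_def)
    qed (simp add: ergm_weight_def)
    finally show ?thesis .
  qed
  then have "C * (q ^ 2 * exp (27 / real n * (\<Sum>p=2..k. b p))) / (C * exp (real n ^ 2 * q))
      \<le> sum ?w A / ergm_Z k b H n"
    using Z_le ergm_Z_pos[of k b H n]
    by (intro frac_le) (auto intro!: sum_nonneg simp: ergm_weight_def)
  then show ?lower using C by (simp add: meas)
qed

section \<open>Passage to the limit\<close>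

theorem theorem2p2:
  fixes k :: nat
    and \<beta> :: "nat \<Rightarrow> real"
    and H :: "nat \<Rightarrow> 'a pair_pre_digraph"
    and \<alpha> :: "nat \<Rightarrow> real"
    and i j :: nat
  assumes "1 \<le> k"
    and "\<And>p. p \<in> {1..k} \<Longrightarrow> \<beta> p < 0"
    and "\<And>p. p \<in> {1..k} \<Longrightarrow> pair_graph (H p)"
    and "K\<^bsub>2\<^esub> (with_proj (H 1))"
    and "\<And>p. p \<in> {2..k} \<Longrightarrow> card (edges (H p)) \<noteq> 1"
    and "filterlim \<alpha> at_top sequentially"
    and "(\<lambda>n. real n ^ 2 * exp (2 * \<alpha> n * \<beta> 1)) \<longlonglongrightarrow> 0"
    and "(\<lambda>n. \<alpha> n / real n) \<longlonglongrightarrow> 0"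
    and "1 \<le> i" and "1 \<le> j" and "distinct [1, i, j]"
  shows "(\<lambda>n. measure (ergm k (\<lambda>p. \<beta> p * \<alpha> n) H n)
                {G \<in> space (ergm k (\<lambda>p. \<beta> p * \<alpha> n) H n). edge_var 1 i G = 1 \<and> edge_var 1 j G = 1}
              / exp (4 * \<alpha> n * \<beta> 1)) \<longlonglongrightarrow> 1"
proof -
  \<comment> \<open>The normalised probability will be squeezed between
    \<open>exp (s n) / exp (r n)\<close> and \<open>exp (r n)\<close>: \<open>r\<close> bounds the
    contribution of additional edges, \<open>s\<close> that of the \<open>H p\<close> with several
    edges.\<close>
  define r where "r n = real n ^ 2 * exp (2 * \<alpha> n * \<beta> 1)" for n
  define s where "s n = 27 * (\<Sum>p=2..k. \<beta> p) * (\<alpha> n / real n)" for n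
  define P where "P n = measure (ergm k (\<lambda>p. \<beta> p * \<alpha> n) H n)
    {G \<in> space (ergm k (\<lambda>p. \<beta> p * \<alpha> n) H n). edge_var 1 i G = 1 \<and> edge_var 1 j G = 1}" for n
  have r: "r \<longlonglongrightarrow> 0" using assms(7) by (simp add: r_def[abs_def])
  have s: "s \<longlonglongrightarrow> 0"
    unfolding s_def[abs_def] using tendsto_mult_right_zero[OF assms(8)] .
  have ij: "1 < i" "1 < j" "i \<noteq> j" using assms(9-11) by auto
  \<comment> \<open>The bounds at fixed \<open>n\<close> require nonpositive parameters; with
    \<beta> negative this holds once \<alpha> is nonnegative.\<close>
  have "eventually (\<lambda>n. \<alpha> n \<ge> 0) sequentially"
    using assms(6) by (simp add: filterlim_at_top)
  then have bounds: "eventually (\<lambda>n. P n / exp (4 * \<alpha> n * \<beta> 1) \<le> exp (r n) \<and>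
      exp (s n) / exp (r n) \<le> P n / exp (4 * \<alpha> n * \<beta> 1)) sequentially"
    using eventually_ge_at_top[of i] eventually_ge_at_top[of j]
  proof eventually_elim
    case (elim n)
    let ?b = "\<lambda>p. \<beta> p * \<alpha> n" and ?q = "exp (2 * (\<beta> 1 * \<alpha> n))"
    have P: "P n = measure (ergm k ?b H n)
        {G \<in> simple_graphs_on {1..n}. (1, i) \<in> parcs G \<and> (1, j) \<in> parcs G}"
      unfolding P_def ergm_def space_point_measure
      by (rule arg_cong[of _ _ "measure _"]) (auto simp: edge_var_def split: if_splits)
    have b: "?b p \<le> 0" if "p \<in> {1..k}" for p
      using assms(2)[OF that] elim(1) by (simp add: mult_nonpos_nonneg)
    have q: "?q ^ 2 = exp (4 * \<alpha> n * \<beta> 1)"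
      by (simp add: algebra_simps flip: exp_of_nat_mult)
    have rn: "r n = real n ^ 2 * ?q"
      by (simp add: r_def mult_ac)
    have sn: "s n = 27 / real n * (\<Sum>p=2..k. ?b p)"
      by (simp add: s_def flip: sum_distrib_right)
    note bounds = ergm_two_edges_bounds[of k ?b H, OF assms(1) b assms(3,4,5) ij elim(2,3)]
    have "P n \<le> exp (4 * \<alpha> n * \<beta> 1) * exp (r n)"
      using bounds(1) unfolding P q rn by simp
    moreover have "exp (4 * \<alpha> n * \<beta> 1) * exp (s n) / exp (r n) \<le> P n"
      using bounds(2) unfolding P q rn sn by simp
    ultimately show ?case
      by (simp add: field_simps)
  qed
  have "(\<lambda>n. P n / exp (4 * \<alpha> n * \<beta> 1)) \<longlonglongrightarrow> 1"
  proof (rule tendsto_sandwich)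
    show "(\<lambda>n. exp (s n) / exp (r n)) \<longlonglongrightarrow> 1"
      using tendsto_divide[OF tendsto_exp[OF s] tendsto_exp[OF r]] by simp
    show "(\<lambda>n. exp (r n)) \<longlonglongrightarrow> 1"
      using tendsto_exp[OF r] by simp
  qed (use bounds in \<open>auto elim: eventually_mono\<close>)
  then show ?thesis by (simp add: P_def)
qed

end
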